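(* Let $G$ be a graph with $\chi'_{\mathrm{inj}}(G)=k$. Then $\chi_{st}(G)\leq 2^k$.
   Context: All graphs are finite and simple. A star coloring of $G$ is a proper vertex coloring of $G$ such that the union of any two color classes induces a star forest in $G$, i.e. every component of the induced subgraph is a star. The star chromatic number $\chi_{st}(G)$ is the smallest integer $k$ for which $G$ admits a star coloring with $k$ colors. Three edges $e_1,e_2,e_3$ of a graph are consecutive if they form (in this order) a path of length three or a cycle of length three. An injective edge-coloring of $G$ with $k$ colors is a map $c:E(G)\to\{1,\dots,k\}$ (not necessarily a proper edge-coloring) such that $c(e_1)\neq c(e_3)$ whenever $e_1,e_2,e_3$ are consecutive edges in $G$. The injective chromatic index $\chi'_{\mathrm{inj}}(G)$ is the minimum $k$ such that $G$ has an injective edge-coloring with $k$ colors. *)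

theory Defs
  imports Main
begin

text \<open>A graph is given by its vertex set and its set of edges, an edge being a two-element
  set of vertices.\<close>

definition finite_simple_graph :: "'a set \<Rightarrow> 'a set set \<Rightarrow> bool" where
  "finite_simple_graph V E \<longleftrightarrow> finite V \<and> (\<forall>e\<in>E. e \<subseteq> V \<and> card e = 2)"

definition induced_edges :: "'a set set \<Rightarrow> 'a set \<Rightarrow> 'a set set" where
  "induced_edges E W = {e \<in> E. e \<subseteq> W}"

definition reachable :: "'a set set \<Rightarrow> 'a \<Rightarrow> 'a \<Rightarrow> bool" where
  "reachable E = (\<lambda>u v. {u, v} \<in> E)\<^sup>*\<^sup>*"

definition components :: "'a set \<Rightarrow> 'a set set \<Rightarrow> 'a set set" where
  "components V E = {{u \<in> V. reachable E v u} | v. v \<in> V}"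

text \<open>A star is a complete bipartite graph \<open>K\<^bsub>1,m\<^esub>\<close> with \<open>m \<ge> 0\<close>; in particular a single
  vertex is a star.\<close>

definition star :: "'a set \<Rightarrow> 'a set set \<Rightarrow> bool" where
  "star V E \<longleftrightarrow> (\<exists>x\<in>V. E = {{x, y} | y. y \<in> V - {x}})"

definition star_forest :: "'a set \<Rightarrow> 'a set set \<Rightarrow> bool" where
  "star_forest V E \<longleftrightarrow> (\<forall>C\<in>components V E. star C (induced_edges E C))"

definition proper_coloring :: "'a set \<Rightarrow> 'a set set \<Rightarrow> nat \<Rightarrow> ('a \<Rightarrow> nat) \<Rightarrow> bool" where
  "proper_coloring V E k f \<longleftrightarrow>
     (\<forall>v\<in>V. f v \<in> {1..k}) \<and> (\<forall>u v. {u, v} \<in> E \<longrightarrow> f u \<noteq> f v)"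

definition color_class :: "'a set \<Rightarrow> ('a \<Rightarrow> nat) \<Rightarrow> nat \<Rightarrow> 'a set" where
  "color_class V f i = {v \<in> V. f v = i}"

definition star_coloring :: "'a set \<Rightarrow> 'a set set \<Rightarrow> nat \<Rightarrow> ('a \<Rightarrow> nat) \<Rightarrow> bool" where
  "star_coloring V E k f \<longleftrightarrow> proper_coloring V E k f \<and>
     (\<forall>i\<in>{1..k}. \<forall>j\<in>{1..k}. i \<noteq> j \<longrightarrow>
        (let W = color_class V f i \<union> color_class V f j
         in star_forest W (induced_edges E W)))"

text \<open>The two \<open>LEAST\<close> below are minima of nonempty sets for every finite simple graph: an
  injective colouring of the vertices (of the edges) is a star colouring (an injective
  edge-colouring).\<close>

definition star_chromatic_number :: "'a set \<Rightarrow> 'a set set \<Rightarrow> nat" where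
  "star_chromatic_number V E = (LEAST k. \<exists>f. star_coloring V E k f)"

text \<open>The first disjunct is a path of length three, the second a cycle of length three.\<close>

definition consecutive :: "'a set set \<Rightarrow> 'a set \<Rightarrow> 'a set \<Rightarrow> 'a set \<Rightarrow> bool" where
  "consecutive E e1 e2 e3 \<longleftrightarrow> e1 \<in> E \<and> e2 \<in> E \<and> e3 \<in> E \<and>
     ((\<exists>a b c d. distinct [a, b, c, d] \<and> e1 = {a, b} \<and> e2 = {b, c} \<and> e3 = {c, d}) \<or>
      (\<exists>a b c. distinct [a, b, c] \<and> e1 = {a, b} \<and> e2 = {b, c} \<and> e3 = {c, a}))"

definition injective_edge_coloring :: "'a set set \<Rightarrow> nat \<Rightarrow> ('a set \<Rightarrow> nat) \<Rightarrow> bool" where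
  "injective_edge_coloring E k c \<longleftrightarrow> (\<forall>e\<in>E. c e \<in> {1..k}) \<and>
     (\<forall>e1 e2 e3. consecutive E e1 e2 e3 \<longrightarrow> c e1 \<noteq> c e3)"

definition injective_chromatic_index :: "'a set set \<Rightarrow> nat" where
  "injective_chromatic_index E = (LEAST k. \<exists>c. injective_edge_coloring E k c)"

end

theory Submission
  imports Defs
begin

text \<open>In an injective edge-colouring every colour class is a disjoint union of stars, and no edge
  joins two of them. Fix a centre of each star (either endpoint, for a single edge), and colour a
  vertex \<open>v\<close> with the set of those colours \<open>i\<close> for which \<open>v\<close> is the centre of a star of colour
  \<open>i\<close>. If \<open>xy\<close> is an edge of colour \<open>i\<close> with centre \<open>x\<close>, then neither \<open>y\<close> nor any neighbour
  \<open>z \<noteq> x\<close> of \<open>y\<close> is a centre of colour \<open>i\<close>. The former makes the colouring proper; the latter,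
  applied to the middle edge of a path on four vertices, shows that the path is not bicoloured.\<close>

section \<open>Star forests and bicoloured paths\<close>

text \<open>A vertex whose neighbours are all leaves is the centre of a star that fills its
  component. Each \<open>v\<close> is such a vertex or is adjacent to one, for otherwise a triangle
  or a path on four vertices appears.\<close>

lemma star_forest_if_no_triangle_no_path4:
  assumes edges: "\<And>e. e \<in> F \<Longrightarrow> e \<subseteq> W \<and> card e = 2"
    and no_triangle: "\<And>a b c. {a, b} \<in> F \<Longrightarrow> {b, c} \<in> F \<Longrightarrow> {c, a} \<in> F \<Longrightarrow> False"
    and no_path: "\<And>a b c d. distinct [a, b, c, d] \<Longrightarrow> {a, b} \<in> F \<Longrightarrow> {b, c} \<in> F \<Longrightarrow> {c, d} \<in> F
      \<Longrightarrow> False"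
  shows "star_forest W F"
  unfolding star_forest_def
proof
  fix C assume "C \<in> components W F"
  then obtain v where v: "v \<in> W" and C: "C = {u \<in> W. reachable F v u}"
    by (auto simp: components_def)
  have neq: "a \<noteq> b" if "{a, b} \<in> F" for a b
    using edges[OF that] by auto
  obtain x where x: "x = v \<or> {v, x} \<in> F"
    and closed: "\<And>y z. {x, y} \<in> F \<Longrightarrow> {y, z} \<in> F \<Longrightarrow> z = x"
  \<comment> \<open>If \<open>v\<close> has a unique neighbour \<open>w\<close>, take
    \<open>x = w\<close>: a violation of \<open>closed\<close> gives a path
    \<open>v, w, y, z\<close>. Otherwise take \<open>x = v\<close>: a violation
    \<open>v, y, z\<close> extends backwards to a second neighbour \<open>y'\<close> of
    \<open>v\<close>, or closes a triangle when \<open>z = y'\<close>.\<close>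
  proof (cases "\<exists>w. {v, w} \<in> F \<and> (\<forall>w'. {v, w'} \<in> F \<longrightarrow> w' = w)")
    case True
    then obtain w where w: "{v, w} \<in> F" and uniq: "\<And>w'. {v, w'} \<in> F \<Longrightarrow> w' = w"
      by blast
    have "z = w" if "{w, y} \<in> F" "{y, z} \<in> F" for y z
    proof (rule ccontr)
      assume "z \<noteq> w"
      then have "y \<noteq> v" using uniq that by blast
      moreover have "z \<noteq> v" using uniq[of y] that neq by (auto simp: insert_commute)
      ultimately have "distinct [v, w, y, z]"
        using \<open>z \<noteq> w\<close> neq w that by auto
      then show False using no_path w that by blast
    qed
    with that w show ?thesis by blast
  next
    case False
    have "z = v" if vy: "{v, y} \<in> F" and yz: "{y, z} \<in> F" for y z
    proof (rule ccontr)
      assume "z \<noteq> v"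
      obtain y' where y': "{v, y'} \<in> F" "y' \<noteq> y" using False vy by blast
      have "z \<noteq> y'" using no_triangle[of v y z] vy yz y' by (auto simp: insert_commute)
      then have "distinct [y', v, y, z]"
        using \<open>z \<noteq> v\<close> y' neq vy yz by auto
      then show False using no_path[of y' v y z] y' vy yz by (simp add: insert_commute)
    qed
    with that show ?thesis by blast
  qed
  \<comment> \<open>By \<open>closed\<close>, a walk that has stepped from \<open>x\<close> to a
    neighbour can only return to \<open>x\<close>.\<close>
  have near: "u = x \<or> {x, u} \<in> F" if "reachable F v u" for u
    using that unfolding reachable_def
  proof (induction rule: rtranclp_induct)
    case base
    then show ?case using x by (auto simp: insert_commute)
  next
    case (step y z)
    then show ?case using closed by blast
  qed
  have "x \<in> C"
    using x v edges by (auto simp: C reachable_def)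
  moreover have "induced_edges F C = {{x, y} | y. y \<in> C - {x}}"
  proof (intro equalityI subsetI)
    fix e assume "e \<in> induced_edges F C"
    then have e: "e \<in> F" "e \<subseteq> C" by (auto simp: induced_edges_def)
    then obtain a b where ab: "e = {a, b}" "a \<noteq> b"
      using edges by (meson card_2_iff)
    have "a = x \<or> {x, a} \<in> F" "b = x \<or> {x, b} \<in> F"
      using near e ab by (auto simp: C)
    then have "a = x \<or> b = x"
      using no_triangle[of x a b] e ab by (auto simp: insert_commute)
    then show "e \<in> {{x, y} | y. y \<in> C - {x}}"
      using e ab by (auto simp: insert_commute)
  next
    fix e assume "e \<in> {{x, y} | y. y \<in> C - {x}}"
    then obtain y where y: "e = {x, y}" "y \<in> C" "y \<noteq> x" by blast
    then have "e \<in> F" using near by (auto simp: C)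
    then show "e \<in> induced_edges F C" using y \<open>x \<in> C\<close> by (simp add: induced_edges_def)
  qed
  ultimately show "star C (induced_edges F C)"
    unfolding star_def by blast
qed

text \<open>By properness the two colours alternate along every walk in the subgraph. This excludes
  triangles, and a path on four vertices would be coloured \<open>i, j, i, j\<close> or
  \<open>j, i, j, i\<close>.\<close>

lemma star_coloring_if_no_bicolored_path4:
  assumes G: "finite_simple_graph V E"
    and proper: "proper_coloring V E k f"
    and no_path: "\<And>a b c d. distinct [a, b, c, d] \<Longrightarrow> {a, b} \<in> E \<Longrightarrow> {b, c} \<in> E \<Longrightarrow> {c, d} \<in> E
      \<Longrightarrow> f a = f c \<Longrightarrow> f b = f d \<Longrightarrow> False"
  shows "star_coloring V E k f"
  unfolding star_coloring_def Let_def
proof (intro conjI ballI impI)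
  fix i j :: nat assume "i \<noteq> j"
  let ?W = "color_class V f i \<union> color_class V f j"
  let ?F = "induced_edges E ?W"
  have F: "{a, b} \<in> E" "f a = i \<and> f b = j \<or> f a = j \<and> f b = i" if "{a, b} \<in> ?F" for a b
  proof -
    show "{a, b} \<in> E" using that by (simp add: induced_edges_def)
    then have "f a \<noteq> f b" using proper by (simp add: proper_coloring_def)
    then show "f a = i \<and> f b = j \<or> f a = j \<and> f b = i"
      using that by (auto simp: induced_edges_def color_class_def)
  qed
  show "star_forest ?W ?F"
  proof (rule star_forest_if_no_triangle_no_path4)
    show "e \<subseteq> ?W \<and> card e = 2" if "e \<in> ?F" for e
      using that G by (auto simp: induced_edges_def finite_simple_graph_def)
    show False if "{a, b} \<in> ?F" "{b, c} \<in> ?F" "{c, a} \<in> ?F" for a b c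
      using F(2)[OF that(1)] F(2)[OF that(2)] F(2)[OF that(3)] \<open>i \<noteq> j\<close> by auto
    show False if "distinct [a, b, c, d]" "{a, b} \<in> ?F" "{b, c} \<in> ?F" "{c, d} \<in> ?F" for a b c d
      using F(2)[OF that(2)] F(2)[OF that(3)] F(2)[OF that(4)] \<open>i \<noteq> j\<close>
        no_path[OF that(1) F(1)[OF that(2)] F(1)[OF that(3)] F(1)[OF that(4)]] by auto
  qed
qed (rule proper)

section \<open>Injective edge-colourings and star centres\<close>

text \<open>Treats both forms of \<open>consecutive\<close> at once: \<open>w = x\<close> closes a
  triangle, any other \<open>w\<close> gives a path.\<close>

lemma consecutiveI:
  assumes "{x, y} \<in> E" "{y, z} \<in> E" "{z, w} \<in> E"
    and "distinct [x, y, z]" "w \<noteq> y" "w \<noteq> z"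
  shows "consecutive E {x, y} {y, z} {z, w}"
proof (cases "w = x")
  case True
  then have "\<exists>a b c. distinct [a, b, c] \<and> {x, y} = {a, b} \<and> {y, z} = {b, c} \<and> {z, w} = {c, a}"
    using assms by (intro exI[of _ x] exI[of _ y] exI[of _ z]) simp
  then show ?thesis
    using assms by (simp only: consecutive_def simp_thms)
next
  case False
  then have "\<exists>a b c d. distinct [a, b, c, d] \<and> {x, y} = {a, b} \<and> {y, z} = {b, c} \<and> {z, w} = {c, d}"
    using assms by (intro exI[of _ x] exI[of _ y] exI[of _ z] exI[of _ w]) auto
  then show ?thesis
    using assms by (simp only: consecutive_def simp_thms)
qed

text \<open>If neither end of \<open>e = {x, y}\<close> served, its colour would occur on an edge
  through \<open>x\<close> missing \<open>y\<close> and on an edge through \<open>y\<close> missing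
  \<open>x\<close>. With \<open>e\<close> between them, these are consecutive.\<close>

lemma injective_edge_coloring_center:
  assumes G: "finite_simple_graph V E"
    and c: "injective_edge_coloring E k c"
    and e: "e \<in> E"
  obtains x where "x \<in> e"
    and "\<And>e'. e' \<in> E \<Longrightarrow> c e' = c e \<Longrightarrow> e' \<inter> e \<noteq> {} \<Longrightarrow> x \<in> e'"
proof -
  note center = that
  obtain x y where xy: "e = {x, y}" "x \<noteq> y"
    using G e by (meson card_2_iff finite_simple_graph_def)
  show ?thesis
  proof (rule ccontr)
    assume "\<not> thesis"
    then have no_center: "\<exists>e'\<in>E. c e' = c e \<and> e' \<inter> e \<noteq> {} \<and> z \<notin> e'" if "z \<in> e" for z
      using center that by blast
    obtain e1 where e1: "e1 \<in> E" "c e1 = c e" "x \<in> e1" "y \<notin> e1"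
      using no_center[of y] xy by blast
    obtain e3 where e3: "e3 \<in> E" "c e3 = c e" "y \<in> e3" "x \<notin> e3"
      using no_center[of x] xy by blast
    have pair: "\<exists>a. e' = {u, a} \<and> a \<noteq> u" if "e' \<in> E" "u \<in> e'" for e' u
    proof -
      have "card e' = 2" using G that by (simp add: finite_simple_graph_def)
      then show ?thesis using that by (auto simp: card_2_iff)
    qed
    obtain a where a: "e1 = {x, a}" "a \<noteq> x" using pair e1 by blast
    obtain b where b: "e3 = {y, b}" "b \<noteq> y" using pair e3 by blast
    have "consecutive E {a, x} {x, y} {y, b}"
      using a b xy e e1 e3 by (intro consecutiveI) (auto simp: insert_commute)
    then have "consecutive E e1 e e3"
      using a b xy by (simp add: insert_commute)
    then show False using c e1 e3 by (metis injective_edge_coloring_def)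
  qed
qed

lemma star_coloring_of_injective_edge_coloring:
  assumes G: "finite_simple_graph V E"
    and c: "injective_edge_coloring E k c"
  shows "\<exists>f. star_coloring V E (2 ^ k) f"
proof -
  have "\<forall>e\<in>E. \<exists>x. x \<in> e \<and> (\<forall>e'\<in>E. c e' = c e \<longrightarrow> e' \<inter> e \<noteq> {} \<longrightarrow> x \<in> e')"
  proof
    fix e assume "e \<in> E"
    from injective_edge_coloring_center[OF G c this]
    show "\<exists>x. x \<in> e \<and> (\<forall>e'\<in>E. c e' = c e \<longrightarrow> e' \<inter> e \<noteq> {} \<longrightarrow> x \<in> e')" by metis
  qed
  \<comment> \<open>Centres are chosen edge by edge, yet consistently: distinct edges of one colour
    that meet share a single vertex, which is the centre of both.\<close>
  then obtain center where center_in: "\<And>e. e \<in> E \<Longrightarrow> center e \<in> e"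
    and center: "\<And>e e'. e \<in> E \<Longrightarrow> e' \<in> E \<Longrightarrow> c e' = c e \<Longrightarrow> e' \<inter> e \<noteq> {} \<Longrightarrow> center e \<in> e'"
    by metis
  have card2: "card e = 2" if "e \<in> E" for e
    using G that by (simp add: finite_simple_graph_def)
  have neq: "a \<noteq> b" if "{a, b} \<in> E" for a b
    using card2[OF that] by auto
  define S where "S v = {c e | e. e \<in> E \<and> center e = v}" for v
  have S_sub: "S v \<subseteq> {1..k}" for v
    using c by (auto simp: S_def injective_edge_coloring_def)
  have S_center: "c e \<in> S (center e)" if "e \<in> E" for e
    using that by (auto simp: S_def)
  \<comment> \<open>An edge of this colour centred at \<open>y\<close> meets \<open>{x, y}\<close>,
    so it also contains \<open>x\<close>. It is then \<open>{x, y}\<close> itself, whose centre is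
    \<open>x\<close>.\<close>
  have not_in_S_end: "c {x, y} \<notin> S y" if e: "{x, y} \<in> E" "center {x, y} = x" for x y
  proof
    assume "c {x, y} \<in> S y"
    then obtain e' where e': "e' \<in> E" "center e' = y" "c e' = c {x, y}"
      unfolding S_def by auto
    have "y \<in> e'" using center_in e' by blast
    moreover have "x \<in> e'" using center[OF e(1) e'(1,3)] e(2) \<open>y \<in> e'\<close> by auto
    ultimately have "e' = {x, y}"
      using card2[OF e'(1)] neq[OF e(1)] by (metis card_2_iff doubleton_eq_iff insertE singletonD)
    then show False using e e' neq by metis
  qed
  have not_in_S_next: "c {x, y} \<notin> S z"
    if e: "{x, y} \<in> E" "center {x, y} = x" "{y, z} \<in> E" "z \<noteq> x" for x y z
  proof
    assume "c {x, y} \<in> S z"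
    then obtain e' where e': "e' \<in> E" "center e' = z" "c e' = c {x, y}"
      unfolding S_def by auto
    have "z \<in> e'" using center_in e' by blast
    then obtain w where w: "e' = {z, w}" "z \<noteq> w"
      using card2[OF e'(1)] by (auto simp: card_2_iff)
    \<comment> \<open>If \<open>w = y\<close>, then \<open>e'\<close> meets \<open>{x, y}\<close>
      and must contain its centre \<open>x\<close>, but \<open>e'\<close> is \<open>{z, y}\<close>
      with \<open>z \<noteq> x\<close>.\<close>
    have "w \<noteq> y"
      using center[OF e(1) e'(1,3)] e w neq[OF e(1)] by auto
    then have "consecutive E {x, y} {y, z} {z, w}"
      using w e e' neq by (intro consecutiveI) auto
    then show False using c e' w by (metis injective_edge_coloring_def)
  qed
  have center_cases: "center {u, v} = u \<or> center {u, v} = v" if "{u, v} \<in> E" for u v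
    using center_in[OF that] by auto
  have S_proper: "S u \<noteq> S v" if uv: "{u, v} \<in> E" for u v
    using center_cases[OF uv]
  proof
    assume "center {u, v} = u"
    then show ?thesis using S_center[OF uv] not_in_S_end[OF uv] by metis
  next
    assume "center {u, v} = v"
    then show ?thesis
      using S_center[OF uv] not_in_S_end[of v u] uv by (metis insert_commute)
  qed
  have S_path: False
    if pqrs: "distinct [p, q, r, s]" and pq: "{p, q} \<in> E" and qr: "{q, r} \<in> E"
      and rs: "{r, s} \<in> E" and eq: "S p = S r" "S q = S s"
    for p q r s
    using center_cases[OF qr]
  proof
    assume center: "center {q, r} = q"
    then have "c {q, r} \<notin> S s" using not_in_S_next[OF qr center rs] pqrs by auto
    then show False using S_center[OF qr] center eq by simp
  next
    \<comment> \<open>The previous case for the reversed path \<open>s, r, q, p\<close>: the colour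
      of the middle edge now separates \<open>S r\<close> from \<open>S p\<close>.\<close>
    assume center: "center {q, r} = r"
    have rq: "{r, q} = {q, r}" and qp: "{q, p} = {p, q}" by auto
    have "c {q, r} \<notin> S p"
      using not_in_S_next[of r q p, unfolded rq qp, OF qr center pq] pqrs by auto
    then show False using S_center[OF qr] center eq by simp
  qed
  \<comment> \<open>\<open>h\<close> numbers the subsets of \<open>{1..k}\<close>, which turns the
    sets \<open>S v\<close> into colours in \<open>{1..2 ^ k}\<close> while keeping equal sets equal
    and distinct sets distinct.\<close>
  have "card (Pow {1..k}) = card {1..(2::nat) ^ k}"
    by (simp add: card_Pow)
  then obtain h where h: "bij_betw h (Pow {1..k}) {1..(2::nat) ^ k}"
    using bij_betw_iff_card[of "Pow {1..k}" "{1..(2::nat) ^ k}"] by auto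
  have h_eq: "h (S u) = h (S v) \<longleftrightarrow> S u = S v" for u v
    by (rule inj_on_eq_iff[OF bij_betw_imp_inj_on[OF h]]) (simp_all only: Pow_iff S_sub)
  have "star_coloring V E (2 ^ k) (h \<circ> S)"
  proof (rule star_coloring_if_no_bicolored_path4[OF G])
    have "h (S v) \<in> {1..2 ^ k}" for v
      by (rule bij_betw_apply[OF h]) (simp only: Pow_iff S_sub)
    then show "proper_coloring V E (2 ^ k) (h \<circ> S)"
      using S_proper by (simp add: proper_coloring_def h_eq)
    show False
      if "distinct [a, b, c, d]" "{a, b} \<in> E" "{b, c} \<in> E" "{c, d} \<in> E"
        "(h \<circ> S) a = (h \<circ> S) c" "(h \<circ> S) b = (h \<circ> S) d" for a b c d
      using S_path[OF that(1-4)] that(5,6) h_eq by simp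
  qed
  then show ?thesis by blast
qed

text \<open>Giving each edge its own colour works, as the outer edges of a consecutive triple
  differ. Hence the \<open>LEAST\<close> in \<open>injective_chromatic_index\<close> is attained by
  some colouring.\<close>

lemma ex_injective_edge_coloring:
  assumes "finite_simple_graph V E"
  shows "\<exists>k c. injective_edge_coloring E k c"
proof -
  have "finite E"
    using assms by (auto simp: finite_simple_graph_def intro: finite_subset[of E "Pow V"])
  then obtain c where c: "bij_betw c E {1..card E}"
    using bij_betw_iff_card[of E "{1..card E}"] by auto
  have "c e1 \<noteq> c e3" if "consecutive E e1 e2 e3" for e1 e2 e3
  proof -
    have "e1 \<in> E" "e3 \<in> E" "e1 \<noteq> e3"
      using that by (auto simp: consecutive_def doubleton_eq_iff)
    then show ?thesis
      using inj_on_eq_iff[OF bij_betw_imp_inj_on[OF c]] by simp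
  qed
  moreover have "c e \<in> {1..card E}" if "e \<in> E" for e
    using bij_betw_apply[OF c that] .
  ultimately have "injective_edge_coloring E (card E) c"
    by (simp add: injective_edge_coloring_def)
  then show ?thesis by blast
qed

theorem theorem1p8:
  fixes V :: "'a set" and E :: "'a set set" and k :: nat
  assumes "finite_simple_graph V E"
    and "injective_chromatic_index E = k"
  shows "star_chromatic_number V E \<le> 2 ^ k"
proof -
  obtain c where "injective_edge_coloring E k c"
    using LeastI_ex[OF ex_injective_edge_coloring[OF assms(1)]] assms(2)
    unfolding injective_chromatic_index_def by blast
  then show ?thesis
    unfolding star_chromatic_number_def
    using star_coloring_of_injective_edge_coloring[OF assms(1)] by (blast intro: Least_le)
qed

end
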